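(* Let $d\in\mathbb{N}$, let $N\ge 0$ be an integer, let $\omega$ be an admissible radial measure on $\mathbb{B}_d$, and let $f\in B^N_\omega$ be cyclic in $B^N_\omega$. If $\omega'$ is an admissible radial measure on $\mathbb{B}_d$ which is a perturbation of $\omega$ with parameter $\varepsilon>0$, and $\varepsilon$ is sufficiently small, then $f$ is cyclic in $B^N_{\omega'}$. Moreover, there exists a constant $C>0$ such that $$\mathcal{C}_{\omega'}(f)\le C\,\varepsilon,$$ where $\mathcal{C}_{\omega'}(f)$ denotes the cyclicity index of $f$ in the space $B^N_{\omega'}$.
   Context: $\mathbb{B}_d$ is the open unit ball of $\mathbb{C}^d$. A measure $\omega$ on $\mathbb{B}_d$ is an admissible radial measure if it has the form $d\omega(z)=d\mu(r)\,d\sigma(w)$, $z=rw$, $0\le r<1$, $w\in\partial\mathbb{B}_d$, where $\sigma$ is the normalized rotation-invariant measure on $\partial\mathbb{B}_d$ and $\mu$ is a Borel measure on $[0,1]$ with $\mu((r,1])>0$ for all $0<r<1$. With the radial derivative $R=\sum_{j=1}^d z_j\frac{\partial}{\partial z_j}$, the radially weighted Besov space is $B^N_\omega=\{f\in\operatorname{Hol}(\mathbb{B}_d): R^Nf\in L^2(\omega)\}$, with norm $\|f\|_{B^N_\omega}^2=\|f\|_{L^2(\omega)}^2$ if $N=0$ and $\|f\|_{B^N_\omega}^2=\omega(\mathbb{B}_d)|f(0)|^2+\|R^Nf\|_{L^2(\omega)}^2$ if $N>0$. For $H=B^N_\omega$, the multiplier algebra is $\operatorname{Mult}(H)=\{\varphi:\varphi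 h\in H\text{ for all }h\in H\}$ (functions $\varphi$ on $\mathbb{B}_d$). For $f\in H$, $[f]=\overline{\{\varphi f:\varphi\in\operatorname{Mult}(H)\}}$, with closure in the norm of $H$; $f$ is cyclic in $H$ if $[f]=H$. The cyclicity index of $f$ in $B^N_{\omega'}$ is $\mathcal{C}_{\omega'}(f)=\inf\{\|1-\psi f\|_{B^N_{\omega'}}:\psi\in\operatorname{Mult}(B^N_{\omega'})\}$. For admissible radial measures $\omega,\omega'$, $\omega'$ is a perturbation of $\omega$ with parameter $\varepsilon>0$ if $(1-\varepsilon)\,\omega(E)\le\omega'(E)\le(1+\varepsilon)\,\omega(E)$ for all measurable sets $E\subset\mathbb{B}_d$. *)

theory Defs
  imports "HOL-Probability.Probability"
begin

text \<open>
  Complex \<open>d\<close>-space is \<^typ>\<open>complex^'d\<close> with \<open>d = CARD('d)\<close>; its norm is the Euclidean one.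
  Functions on the open unit ball are total functions whose values outside the ball are
  irrelevant: every notion below depends only on the restriction to the ball.
\<close>

abbreviation unit_ball :: "(complex^'d) set" where
  "unit_ball \<equiv> ball 0 1"

abbreviation unit_sphere :: "(complex^'d) set" where
  "unit_sphere \<equiv> sphere 0 1"

subsection \<open>Measures\<close>

text \<open>
  \<^const>\<open>orthogonal_transformation\<close> refers to the underlying real inner product, so these are the
  rotations and reflections of the sphere in real \<open>2d\<close>-space. Exactly one measure has this property.
\<close>

definition normalized_rotation_invariant :: "(complex^'d) measure \<Rightarrow> bool" where
  "normalized_rotation_invariant \<sigma> \<longleftrightarrow>
     sets \<sigma> = sets (restrict_space borel unit_sphere) \<and> prob_space \<sigma> \<and>
     (\<forall>U. orthogonal_transformation U \<longrightarrow> distr \<sigma> \<sigma> U = \<sigma>)"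

text \<open>
  The measure \<open>\<mu>\<close> is finite, as it must be for \<open>\<omega>(B) |f(0)|\<^sup>2\<close> to make sense in the norm.
  It lives on the closed interval, but only its restriction to \<open>0 \<le> r < 1\<close> enters \<open>\<omega>\<close>.
\<close>

definition admissible_radial :: "(complex^'d) measure \<Rightarrow> bool" where
  "admissible_radial \<omega> \<longleftrightarrow>
     (\<exists>(\<mu> :: real measure) (\<sigma> :: (complex^'d) measure).
        sets \<mu> = sets (restrict_space borel {0..1}) \<and> finite_measure \<mu> \<and>
        (\<forall>r. 0 < r \<and> r < 1 \<longrightarrow> emeasure \<mu> {r<..1} > 0) \<and>
        normalized_rotation_invariant \<sigma> \<and>
        \<omega> = distr (restrict_space \<mu> {0..<1} \<Otimes>\<^sub>M \<sigma>) (restrict_space borel unit_ball)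
              (\<lambda>(r, w). r *\<^sub>R w))"

definition perturbation :: "(complex^'d) measure \<Rightarrow> real \<Rightarrow> (complex^'d) measure \<Rightarrow> bool" where
  "perturbation \<omega> \<epsilon> \<omega>' \<longleftrightarrow> \<epsilon> > 0 \<and>
     (\<forall>E. E \<in> sets borel \<and> E \<subseteq> unit_ball \<longrightarrow>
        (1 - \<epsilon>) * measure \<omega> E \<le> measure \<omega>' E \<and> measure \<omega>' E \<le> (1 + \<epsilon>) * measure \<omega> E)"

subsection \<open>Holomorphic functions and the radial derivative\<close>

definition Hol :: "(complex^'d \<Rightarrow> complex) set" where
  "Hol = {f. \<forall>z\<in>unit_ball. \<exists>D. (f has_derivative D) (at z) \<and> (\<forall>c v. D (c *s v) = c * D v)}"

definition partial_deriv :: "'d \<Rightarrow> (complex^'d \<Rightarrow> complex) \<Rightarrow> complex^'d \<Rightarrow> complex" where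
  "partial_deriv j f z = deriv (\<lambda>t. f (\<chi> i. if i = j then t else z $ i)) (z $ j)"

definition radial_deriv :: "(complex^'d \<Rightarrow> complex) \<Rightarrow> complex^'d \<Rightarrow> complex" where
  "radial_deriv f z = (\<Sum>j\<in>UNIV. z $ j * partial_deriv j f z)"

subsection \<open>Radially weighted Besov spaces\<close>

definition L2 :: "(complex^'d) measure \<Rightarrow> (complex^'d \<Rightarrow> complex) set" where
  "L2 \<omega> = {f \<in> borel_measurable \<omega>. integrable \<omega> (\<lambda>z. (cmod (f z))\<^sup>2)}"

definition L2_norm :: "(complex^'d) measure \<Rightarrow> (complex^'d \<Rightarrow> complex) \<Rightarrow> real" where
  "L2_norm \<omega> f = sqrt (\<integral>z. (cmod (f z))\<^sup>2 \<partial>\<omega>)"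

definition besov :: "nat \<Rightarrow> (complex^'d) measure \<Rightarrow> (complex^'d \<Rightarrow> complex) set" where
  "besov N \<omega> = {f \<in> Hol. (radial_deriv ^^ N) f \<in> L2 \<omega>}"

definition besov_norm :: "nat \<Rightarrow> (complex^'d) measure \<Rightarrow> (complex^'d \<Rightarrow> complex) \<Rightarrow> real" where
  "besov_norm N \<omega> f =
     (if N = 0 then L2_norm \<omega> f
      else sqrt (measure \<omega> unit_ball * (cmod (f 0))\<^sup>2 + (L2_norm \<omega> ((radial_deriv ^^ N) f))\<^sup>2))"

subsection \<open>Multipliers and cyclicity\<close>

definition Mult :: "nat \<Rightarrow> (complex^'d) measure \<Rightarrow> (complex^'d \<Rightarrow> complex) set" where
  "Mult N \<omega> = {\<phi>. \<forall>h\<in>besov N \<omega>. (\<lambda>z. \<phi> z * h z) \<in> besov N \<omega>}"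

definition mult_closure ::
    "nat \<Rightarrow> (complex^'d) measure \<Rightarrow> (complex^'d \<Rightarrow> complex) \<Rightarrow> (complex^'d \<Rightarrow> complex) set" where
  "mult_closure N \<omega> f =
     {g \<in> besov N \<omega>. \<forall>e>0. \<exists>\<phi>\<in>Mult N \<omega>. besov_norm N \<omega> (\<lambda>z. g z - \<phi> z * f z) < e}"

definition cyclic :: "nat \<Rightarrow> (complex^'d) measure \<Rightarrow> (complex^'d \<Rightarrow> complex) \<Rightarrow> bool" where
  "cyclic N \<omega> f \<longleftrightarrow> f \<in> besov N \<omega> \<and> mult_closure N \<omega> f = besov N \<omega>"

definition cyclicity_index :: "nat \<Rightarrow> (complex^'d) measure \<Rightarrow> (complex^'d \<Rightarrow> complex) \<Rightarrow> real" where
  "cyclicity_index N \<omega> f = (INF \<psi>\<in>Mult N \<omega>. besov_norm N \<omega> (\<lambda>z. 1 - \<psi> z * f z))"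

end

theory Submission
  imports Defs
begin

text \<open>
  A perturbation with parameter at most one half makes each of the two measures at most twice the
  other, so the two Besov spaces have the same elements, the same multipliers and equivalent
  norms. Hence cyclicity transfers, and since the constant \<open>1\<close> lies in the space, the cyclicity
  index of a cyclic function is zero.
\<close>

text \<open>The setwise bound is exactly \<open>M' \<le> scale_measure c M\<close> in the order on
  measures, and the nonnegative integral is monotone in that order.\<close>

lemma nn_integral_mono_emeasure:
  assumes sets: "sets M = sets M'"
    and le: "\<And>A. A \<in> sets M \<Longrightarrow> emeasure M' A \<le> c * emeasure M A"
    and g: "g \<in> borel_measurable M"
  shows "(\<integral>\<^sup>+x. g x \<partial>M') \<le> c * (\<integral>\<^sup>+x. g x \<partial>M)"
proof -
  have "M' \<le> scale_measure c M"
    \<comment> \<open>The order compares \<open>emeasure\<close> on all sets; on non-measurable ones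
      both sides take the default value 0.\<close>
    by (subst le_measure) (use sets le in \<open>auto simp: le_fun_def emeasure_notin_sets\<close>)
  then have "(\<integral>\<^sup>+x. g x \<partial>M') \<le> (\<integral>\<^sup>+x. g x \<partial>scale_measure c M)"
    using sets by (intro nn_integral_mono_measure) simp_all
  then show ?thesis
    using g by (simp add: nn_integral_scale_measure)
qed

lemma sets_admissible_radial:
  "admissible_radial \<omega> \<Longrightarrow> sets \<omega> = sets (restrict_space borel unit_ball)"
  by (auto simp: admissible_radial_def)

text \<open>Finiteness passes from \<mu> and \<sigma> to their product and then to its image. It
  lets real-valued bounds on \<open>measure\<close> be read as bounds on \<open>emeasure\<close>,
  and makes constants integrable.\<close>

lemma finite_measure_admissible_radial:
  fixes \<omega> :: "(complex^'d) measure"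
  assumes "admissible_radial \<omega>"
  shows "finite_measure \<omega>"
proof -
  obtain \<mu> :: "real measure" and \<sigma> :: "(complex^'d) measure" where
    sets_\<mu>: "sets \<mu> = sets (restrict_space borel {0..1})" and fin: "finite_measure \<mu>"
    and inv: "normalized_rotation_invariant \<sigma>"
    and \<omega>: "\<omega> = distr (restrict_space \<mu> {0..<1} \<Otimes>\<^sub>M \<sigma>) (restrict_space borel unit_ball)
              (\<lambda>(r, w). r *\<^sub>R w)"
    using assms unfolding admissible_radial_def by blast
  let ?\<mu> = "restrict_space \<mu> {0..<1}"
  have sets_\<sigma>: "sets \<sigma> = sets (restrict_space borel unit_sphere)" and prob: "prob_space \<sigma>"
    using inv by (auto simp: normalized_rotation_invariant_def)
  have space_\<mu>: "space \<mu> = {0..1}" and space_\<sigma>: "space \<sigma> = sphere 0 1"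
    using sets_eq_imp_space_eq[OF sets_\<mu>] sets_eq_imp_space_eq[OF sets_\<sigma>]
    by (auto simp: space_restrict_space)
  have "{0..<1} \<in> sets \<mu>"
    unfolding sets_\<mu> by (subst sets_restrict_space_iff) auto
  then have fin_\<mu>: "finite_measure ?\<mu>"
    using fin by (intro finite_measure_restrict_space) (auto simp: space_\<mu>)
  have id_\<mu>: "(\<lambda>r. r) \<in> borel_measurable \<mu>" and id_\<sigma>: "(\<lambda>w. w) \<in> borel_measurable \<sigma>"
    by (simp_all add: measurable_cong_sets[OF sets_\<mu> refl] measurable_cong_sets[OF sets_\<sigma> refl]
        measurable_restrict_space1)
  have id_r: "(\<lambda>r. r) \<in> borel_measurable ?\<mu>"
    using id_\<mu> by (rule measurable_restrict_space1)
  have "(\<lambda>p. fst p *\<^sub>R snd p) \<in> borel_measurable (?\<mu> \<Otimes>\<^sub>M \<sigma>)"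
    using measurable_compose[OF measurable_fst id_r] measurable_compose[OF measurable_snd id_\<sigma>]
    by (rule borel_measurable_scaleR)
  \<comment> \<open>The image lies in the open ball because \<open>r < 1\<close> and
    \<open>w\<close> has norm 1.\<close>
  then have "(\<lambda>(r, w). r *\<^sub>R w) \<in> measurable (?\<mu> \<Otimes>\<^sub>M \<sigma>) (restrict_space borel unit_ball)"
    by (intro measurable_restrict_space2)
      (auto simp: case_prod_beta space_pair_measure space_restrict_space space_\<mu> space_\<sigma>)
  moreover have "finite_measure (?\<mu> \<Otimes>\<^sub>M \<sigma>)"
    using fin_\<mu> prob prob_space.finite_measure by (intro finite_measure_pair_measure) auto
  ultimately show ?thesis
    unfolding \<omega> by (intro finite_measure.finite_measure_distr)
qed

lemma L2_norm_square: "(L2_norm M f)\<^sup>2 = (\<integral>z. (cmod (f z))\<^sup>2 \<partial>M)"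
  unfolding L2_norm_def by (intro real_sqrt_pow2 Bochner_Integration.integral_nonneg) simp

text \<open>The hypotheses are symmetric in the two measures, so a one-sided result can be reversed
  through \<open>swap\<close>. Measurability of the ball serves the term with \<open>f 0\<close> in
  the Besov norm.\<close>

locale comparable_measures =
  fixes \<omega> \<omega>' :: "(complex^'d) measure" and K :: real
  assumes fin: "finite_measure \<omega>" "finite_measure \<omega>'"
    and sets_eq: "sets \<omega> = sets \<omega>'"
    and ball_sets: "unit_ball \<in> sets \<omega>"
    and K_nonneg: "0 \<le> K"
    and le: "\<And>A. A \<in> sets \<omega> \<Longrightarrow> measure \<omega>' A \<le> K * measure \<omega> A"
    and ge: "\<And>A. A \<in> sets \<omega> \<Longrightarrow> measure \<omega> A \<le> K * measure \<omega>' A"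
begin

lemma swap: "comparable_measures \<omega>' \<omega> K"
  using fin sets_eq[symmetric] ball_sets[unfolded sets_eq] K_nonneg le[unfolded sets_eq]
    ge[unfolded sets_eq]
  by (simp add: comparable_measures_def)

lemma nn_integral_le:
  assumes g: "g \<in> borel_measurable \<omega>"
  shows "(\<integral>\<^sup>+x. g x \<partial>\<omega>') \<le> ennreal K * (\<integral>\<^sup>+x. g x \<partial>\<omega>)"
proof (rule nn_integral_mono_emeasure[OF sets_eq _ g])
  fix A assume "A \<in> sets \<omega>"
  then show "emeasure \<omega>' A \<le> ennreal K * emeasure \<omega> A"
    using le[of A] K_nonneg fin
    by (simp add: finite_measure.emeasure_eq_measure ennreal_mult'[symmetric] ennreal_leI)
qed

lemma borel_measurable_eq:
  "borel_measurable \<omega>' = (borel_measurable \<omega> :: (_ \<Rightarrow> 'b::topological_space) set)"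
  using sets_eq by (intro measurable_cong_sets) auto

lemma integrable_imp:
  fixes h :: "_ \<Rightarrow> real"
  assumes "integrable \<omega> h"
  shows "integrable \<omega>' h"
proof -
  have "(\<integral>\<^sup>+x. norm (h x) \<partial>\<omega>') \<le> ennreal K * (\<integral>\<^sup>+x. norm (h x) \<partial>\<omega>)"
    using assms by (intro nn_integral_le) simp
  also have "\<dots> < \<infinity>"
    using assms by (simp add: integrable_iff_bounded ennreal_mult_less_top)
  finally show ?thesis
    using assms by (simp add: integrable_iff_bounded borel_measurable_eq)
qed

lemma integrable_iff: "integrable \<omega>' (h :: _ \<Rightarrow> real) \<longleftrightarrow> integrable \<omega> h"
  using integrable_imp comparable_measures.integrable_imp[OF swap] by blast

text \<open>Membership asks only for measurability and a finite integral, and neither is affected by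
  a factor \<open>K\<close> between the measures.\<close>

lemma L2_eq: "L2 \<omega>' = L2 \<omega>"
  by (simp add: L2_def borel_measurable_eq integrable_iff)

lemma besov_eq: "besov N \<omega>' = besov N \<omega>"
  by (simp add: besov_def L2_eq)

lemma Mult_eq: "Mult N \<omega>' = Mult N \<omega>"
  by (simp add: Mult_def besov_eq)

text \<open>If integrability fails, it fails for both measures, and both integrals are the junk value \<open>0\<close>.\<close>

lemma integral_le:
  assumes nonneg: "\<And>x. 0 \<le> (h x :: real)"
  shows "(\<integral>x. h x \<partial>\<omega>') \<le> K * (\<integral>x. h x \<partial>\<omega>)"
proof (cases "integrable \<omega> h")
  case True
  then have "ennreal (\<integral>x. h x \<partial>\<omega>') \<le> ennreal (K * (\<integral>x. h x \<partial>\<omega>))"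
    using nn_integral_le[of h] integrable_iff[of h] nonneg K_nonneg
    by (simp add: nn_integral_eq_integral ennreal_mult')
  then show ?thesis
    using nonneg K_nonneg by simp
next
  case False
  then show ?thesis
    by (simp add: integrable_iff not_integrable_integral_eq)
qed

lemma L2_norm_square_le: "(L2_norm \<omega>' f)\<^sup>2 \<le> K * (L2_norm \<omega> f)\<^sup>2"
  unfolding L2_norm_square by (rule integral_le) simp

lemma mult_closure_subset_besov: "mult_closure N \<omega>' f \<subseteq> besov N \<omega>"
  unfolding mult_closure_def besov_eq by (rule Collect_restrict)

text \<open>The squared norm is built from an integral and the mass of the ball; each grows by at
  most the factor \<open>K\<close>, hence the square root here.\<close>

lemma besov_norm_le: "besov_norm N \<omega>' f \<le> sqrt K * besov_norm N \<omega> f"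
proof (cases "N = 0")
  case True
  have "sqrt (\<integral>z. (cmod (f z))\<^sup>2 \<partial>\<omega>') \<le> sqrt (K * (\<integral>z. (cmod (f z))\<^sup>2 \<partial>\<omega>))"
    by (intro real_sqrt_le_mono integral_le) simp
  then show ?thesis
    unfolding besov_norm_def L2_norm_def real_sqrt_mult if_P[OF True] .
next
  case False
  have "sqrt (measure \<omega>' unit_ball * (cmod (f 0))\<^sup>2 + (L2_norm \<omega>' ((radial_deriv ^^ N) f))\<^sup>2)
      \<le> sqrt (K * (measure \<omega> unit_ball * (cmod (f 0))\<^sup>2 + (L2_norm \<omega> ((radial_deriv ^^ N) f))\<^sup>2))"
    unfolding distrib_left mult.assoc[symmetric] using le[OF ball_sets] L2_norm_square_le
    by (intro real_sqrt_le_mono add_mono mult_right_mono) simp_all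
  then show ?thesis
    unfolding besov_norm_def real_sqrt_mult if_not_P[OF False] .
qed

text \<open>The same multipliers approximate in both spaces, with the error enlarged by at most
  \<open>sqrt K\<close>.\<close>

lemma mult_closure_subset: "mult_closure N \<omega> f \<subseteq> mult_closure N \<omega>' f"
proof
  fix g assume g: "g \<in> mult_closure N \<omega> f"
  have K: "0 \<le> sqrt K"
    using K_nonneg by simp
  have "\<exists>\<phi>\<in>Mult N \<omega>'. besov_norm N \<omega>' (\<lambda>z. g z - \<phi> z * f z) < e" if "e > 0" for e
  proof -
    \<comment> \<open>Adding 1 keeps the denominator positive even for \<open>K = 0\<close>, and
      leaves \<open>sqrt K * \<delta> = e - \<delta>\<close>, strictly below
      \<open>e\<close>.\<close>
    define \<delta> where "\<delta> = e / (sqrt K + 1)"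
    have \<delta>: "\<delta> > 0" "sqrt K * \<delta> + \<delta> = e"
      using that add_nonneg_pos[OF K zero_less_one]
      by (simp_all add: \<delta>_def add_divide_distrib[symmetric] distrib_right[symmetric] field_simps)
    then obtain \<phi> where \<phi>: "\<phi> \<in> Mult N \<omega>"
      and small: "besov_norm N \<omega> (\<lambda>z. g z - \<phi> z * f z) < \<delta>"
      using g unfolding mult_closure_def by blast
    have "besov_norm N \<omega>' (\<lambda>z. g z - \<phi> z * f z) \<le> sqrt K * \<delta>"
      using mult_left_mono[OF less_imp_le[OF small] K] by (rule order_trans[OF besov_norm_le])
    also have "\<dots> < e"
      using \<delta> by linarith
    finally show ?thesis
      using \<phi> Mult_eq by blast
  qed
  with g show "g \<in> mult_closure N \<omega>' f"
    unfolding mult_closure_def besov_eq by blast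
qed

lemma cyclic_imp: "cyclic N \<omega> f \<Longrightarrow> cyclic N \<omega>' f"
  using mult_closure_subset[of N f] mult_closure_subset_besov[of N f]
  unfolding cyclic_def besov_eq by (metis subset_antisym)

end

lemma comparable_measures_perturbation:
  fixes \<omega> \<omega>' :: "(complex^'d) measure"
  assumes adm: "admissible_radial \<omega>" "admissible_radial \<omega>'"
    and pert: "perturbation \<omega> \<epsilon> \<omega>'" and small: "\<epsilon> \<le> 1/2"
  shows "comparable_measures \<omega> \<omega>' 2"
proof (rule comparable_measures.intro)
  show "unit_ball \<in> sets \<omega>"
    by (simp add: sets_admissible_radial[OF adm(1)] sets_restrict_space_iff)
  fix A assume "A \<in> sets \<omega>"
  then have "A \<in> sets borel" "A \<subseteq> unit_ball"
    by (simp_all add: sets_admissible_radial[OF adm(1)] sets_restrict_space_iff)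
  then have bounds: "(1 - \<epsilon>) * measure \<omega> A \<le> measure \<omega>' A" "measure \<omega>' A \<le> (1 + \<epsilon>) * measure \<omega> A"
    using pert by (auto simp: perturbation_def)
  have "(1 + \<epsilon>) * measure \<omega> A \<le> 2 * measure \<omega> A" "1/2 * measure \<omega> A \<le> (1 - \<epsilon>) * measure \<omega> A"
    using small by (intro mult_right_mono; simp)+
  with bounds show "measure \<omega>' A \<le> 2 * measure \<omega> A" "measure \<omega> A \<le> 2 * measure \<omega>' A"
    by linarith+
qed (use adm in \<open>simp_all add: finite_measure_admissible_radial sets_admissible_radial\<close>)

lemma radial_deriv_const: "radial_deriv (\<lambda>_. c) = (\<lambda>_. 0)"
  by (simp add: fun_eq_iff radial_deriv_def partial_deriv_def)

text \<open>The existential covers both cases at once: the value is \<open>c\<close> for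
  \<open>N = 0\<close> and 0 afterwards.\<close>

lemma funpow_radial_deriv_const: "\<exists>c'. (radial_deriv ^^ N) (\<lambda>_. c) = (\<lambda>_. c')"
  by (induction N) (auto simp: radial_deriv_const)

text \<open>Used with \<open>c = 1\<close>: cyclicity then places the constant function 1 in the
  closure of the multiples of \<open>f\<close>.\<close>

lemma const_in_besov:
  fixes \<omega> :: "(complex^'d) measure"
  assumes "finite_measure \<omega>"
  shows "(\<lambda>_. c) \<in> besov N \<omega>"
proof -
  obtain c' where c': "(radial_deriv ^^ N) (\<lambda>_ :: complex^'d. c) = (\<lambda>_. c')"
    using funpow_radial_deriv_const by blast
  have "(\<lambda>_ :: complex^'d. c) \<in> Hol"
    unfolding Hol_def by (auto intro!: exI[of _ "\<lambda>_. 0"])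
  then show ?thesis
    using assms by (simp add: besov_def L2_def c' finite_measure.integrable_const)
qed

lemma besov_norm_nonneg: "0 \<le> besov_norm N \<omega> f"
  by (simp add: besov_norm_def L2_norm_def)

lemma cyclicity_index_cyclic:
  assumes "finite_measure \<omega>" and "cyclic N \<omega> f"
  shows "cyclicity_index N \<omega> f \<le> 0"
proof (rule field_le_epsilon)
  fix e :: real assume "e > 0"
  moreover have "(\<lambda>_. 1) \<in> mult_closure N \<omega> f"
    using assms const_in_besov by (auto simp: cyclic_def)
  ultimately obtain \<phi> where \<phi>: "\<phi> \<in> Mult N \<omega>" "besov_norm N \<omega> (\<lambda>z. 1 - \<phi> z * f z) < e"
    by (auto simp: mult_closure_def)
  have "cyclicity_index N \<omega> f \<le> besov_norm N \<omega> (\<lambda>z. 1 - \<phi> z * f z)"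
    unfolding cyclicity_index_def
    \<comment> \<open>An infimum of reals lies below its members only if the family is bounded
      below; here 0 is a bound.\<close>
    by (rule cINF_lower[OF _ \<phi>(1)]) (auto intro!: bdd_belowI[of _ 0] besov_norm_nonneg)
  with \<phi> show "cyclicity_index N \<omega> f \<le> 0 + e"
    by simp
qed

text \<open>"Sufficiently small" becomes a threshold fixed, like \<open>C\<close>, before \<epsilon>
  and \<omega>' are given, so both are uniform in the perturbation.\<close>

theorem proposition5p6:
  fixes \<omega> :: "(complex^'d) measure" and N :: nat and f :: "complex^'d \<Rightarrow> complex"
  assumes "admissible_radial \<omega>"
    and "f \<in> besov N \<omega>"
    and "cyclic N \<omega> f"
  shows "\<exists>\<epsilon>\<^sub>0>0. \<exists>C>0. \<forall>\<epsilon> \<omega>'.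
           0 < \<epsilon> \<and> \<epsilon> < \<epsilon>\<^sub>0 \<and> admissible_radial \<omega>' \<and> perturbation \<omega> \<epsilon> \<omega>' \<longrightarrow>
             cyclic N \<omega>' f \<and> cyclicity_index N \<omega>' f \<le> C * \<epsilon>"
proof (rule exI[of _ "1/2"], intro conjI exI[of _ 1] allI impI)
  fix \<epsilon> :: real and \<omega>' :: "(complex^'d) measure"
  assume *: "0 < \<epsilon> \<and> \<epsilon> < 1/2 \<and> admissible_radial \<omega>' \<and> perturbation \<omega> \<epsilon> \<omega>'"
  \<comment> \<open>Below 1/2, the factor \<open>1 + \<epsilon>\<close> is at most 2 and
    \<open>1 - \<epsilon>\<close> is at least 1/2, so \<open>K = 2\<close> works in both
    directions.\<close>
  then interpret comparable_measures \<omega> \<omega>' 2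
    using assms(1) by (intro comparable_measures_perturbation) auto
  show cyc: "cyclic N \<omega>' f"
    using assms(3) by (rule cyclic_imp)
  \<comment> \<open>The index is at most 0, so any positive \<open>C\<close> would do; 1 is
    chosen.\<close>
  show "cyclicity_index N \<omega>' f \<le> 1 * \<epsilon>"
    using cyclicity_index_cyclic[OF fin(2) cyc] * by simp
qed simp_all

end
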